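(* For all graphs $G_1, G_2$ and all integers $k \geq 2$, $$\alpha_k(G_1 \cdot G_2) = \alpha_k(G_1) + \iota(G_1)\,(\alpha_k(G_2) - 1),$$ where $\iota(G_1)$ denotes the number of isolated vertices of $G_1$.
   Context: Graphs are finite, simple, undirected and have at least one vertex. For a graph $G$, $\delta_G(u,v)$ is the length of a shortest path between vertices $u$ and $v$ in $G$ (equal to $\infty$ if there is none). A set $S \subseteq V(G)$ is $k$-independent if $\delta_G(u,v) > k$ for all distinct $u,v \in S$; $\alpha_k(G)$ denotes the maximum size of a $k$-independent set in $G$. An isolated vertex is a vertex of degree $0$. The lexicographic product $G_1 \cdot G_2$ has vertex set $V(G_1)\times V(G_2)$, and $(u_1,u_2),(v_1,v_2)$ are adjacent if and only if $(u_1,v_1)\in E(G_1)$, or $u_1=v_1$ and $(u_2,v_2)\in E(G_2)$. *)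

theory Defs
  imports "Graph_Theory.Pair_Digraph" "Graph_Theory.Shortest_Path"
begin

text \<open>
  A finite simple undirected graph is a \<^locale>\<open>pair_graph\<close>: a finite, loop-free digraph
  without parallel arcs whose arc relation is symmetric, so that each undirected edge is
  represented by its two orientations. This locale admits the graph without vertices.
\<close>

definition graph_dist :: "'a pair_pre_digraph \<Rightarrow> 'a \<Rightarrow> 'a \<Rightarrow> ereal" where
  "graph_dist G u v = wf_digraph.\<mu> (with_proj G) (\<lambda>_. 1) u v"

definition k_independent :: "nat \<Rightarrow> 'a pair_pre_digraph \<Rightarrow> 'a set \<Rightarrow> bool" where
  "k_independent k G S \<longleftrightarrow>
     S \<subseteq> pverts G \<and> (\<forall>u\<in>S. \<forall>v\<in>S. u \<noteq> v \<longrightarrow> graph_dist G u v > ereal (real k))"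

definition k_independence_number :: "nat \<Rightarrow> 'a pair_pre_digraph \<Rightarrow> nat" where
  "k_independence_number k G = Max (card ` {S. k_independent k G S})"

text \<open>
  By symmetry of the arc relation, the out-degree is the degree in the undirected graph.
\<close>

definition isolated_vertices :: "'a pair_pre_digraph \<Rightarrow> 'a set" where
  "isolated_vertices G = {v \<in> pverts G. out_degree (with_proj G) v = 0}"

definition lex_product ::
    "'a pair_pre_digraph \<Rightarrow> 'b pair_pre_digraph \<Rightarrow> ('a \<times> 'b) pair_pre_digraph" where
  "lex_product G H =
     \<lparr> pverts = pverts G \<times> pverts H,
       parcs = {((u1, u2), (v1, v2)) | u1 u2 v1 v2.
                  (u1, u2) \<in> pverts G \<times> pverts H \<and> (v1, v2) \<in> pverts G \<times> pverts H \<and>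
                  ((u1, v1) \<in> parcs G \<or> u1 = v1 \<and> (u2, v2) \<in> parcs H)} \<rparr>"

lemma pair_graph_lex_product:
  assumes "pair_graph G" and "pair_graph H"
  shows "pair_graph (lex_product G H)"
proof -
  interpret G: pair_graph G by fact
  interpret H: pair_graph H by fact
  have fin: "finite (parcs (lex_product G H))"
    by (rule finite_subset[of _ "(pverts G \<times> pverts H) \<times> (pverts G \<times> pverts H)"])
      (auto simp: lex_product_def G.pair_finite_verts H.pair_finite_verts)
  have sym: "symmetric (with_proj (lex_product G H))"
    unfolding symmetric_def
    by (auto simp: lex_product_def sym_def dest: G.arcs_symmetric H.arcs_symmetric)
  show ?thesis
    by unfold_locales
      (use fin sym in \<open>auto simp: lex_product_def G.pair_finite_verts H.pair_finite_verts
         dest: G.no_loops' H.no_loops'\<close>)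
qed

lemma graph_dist_eq:
  assumes "pair_graph G"
  shows "graph_dist G u v =
    (INF p\<in>{p. pre_digraph.awalk (with_proj G) u p v}. ereal (real (length p)))"
proof -
  interpret pair_graph G by fact
  have "awalk_cost (\<lambda>_. 1) p = real (length p)" for p
    by (induction p) auto
  then show ?thesis
    by (simp add: graph_dist_def \<mu>_def)
qed

end

theory Submission
  imports Defs
begin

text \<open>
  In \<open>G \<cdot> H\<close> two vertices with distinct first coordinates are exactly as far apart as these
  coordinates are in \<open>G\<close>. Two vertices with the same first coordinate \<open>u\<close> are at distance at most 2
  if \<open>u\<close> has a neighbour, and exactly as far apart as their second coordinates in \<open>H\<close> if \<open>u\<close> is
  isolated. So for \<open>k \<ge> 2\<close> a \<open>k\<close>-independent set of \<open>G \<cdot> H\<close> projects onto a \<open>k\<close>-independent set of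
  \<open>G\<close>, its fibres being singletons over non-isolated vertices and \<open>k\<close>-independent sets of \<open>H\<close> over
  isolated ones. For the converse bound, note that a maximum \<open>k\<close>-independent set of \<open>G\<close> may be
  assumed to contain all isolated vertices.
\<close>

section \<open>Walk lengths as powers of the arc relation\<close>

lemma (in pair_graph) awalk_relpow_iff:
  "(\<exists>p. awalk u p v \<and> length p = n) \<longleftrightarrow> u \<in> pverts G \<and> (u, v) \<in> parcs G ^^ n"
proof (induction n arbitrary: u)
  \<comment> \<open>The condition \<open>u \<in> pverts G\<close> matters here: the zeroth power is
    the identity on the whole type, while an empty walk must sit at a vertex.\<close>
  case 0
  then show ?case by (auto simp: awalk_Nil_iff)
next
  case (Suc n)
  have "(\<exists>p. awalk u p v \<and> length p = Suc n) \<longleftrightarrow>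
      (\<exists>w p. (u, w) \<in> parcs G \<and> awalk w p v \<and> length p = n)"
  proof
    assume "\<exists>p. awalk u p v \<and> length p = Suc n"
    then show "\<exists>w p. (u, w) \<in> parcs G \<and> awalk w p v \<and> length p = n"
      by (auto simp: length_Suc_conv awalk_Cons_iff) blast
  next
    assume "\<exists>w p. (u, w) \<in> parcs G \<and> awalk w p v \<and> length p = n"
    then obtain w p where "(u, w) \<in> parcs G" "awalk w p v" "length p = n"
      by blast
    then have "awalk u ((u, w) # p) v \<and> length ((u, w) # p) = Suc n"
      by (simp add: awalk_Cons_iff)
    then show "\<exists>p. awalk u p v \<and> length p = Suc n"
      by blast
  qed
  also have "\<dots> \<longleftrightarrow> (\<exists>w. (u, w) \<in> parcs G \<and> w \<in> pverts G \<and> (w, v) \<in> parcs G ^^ n)"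
    using Suc.IH by blast
  also have "\<dots> \<longleftrightarrow> u \<in> pverts G \<and> (u, v) \<in> parcs G ^^ Suc n"
    by (meson in_arcsD1 in_arcsD2 relpow_Suc_D2 relpow_Suc_I2)
  finally show ?case .
qed

text \<open>Distance is an infimum over walks, so it exceeds \<open>k\<close> iff no walk has length
  at most \<open>k\<close>. All \<open>n \<le> k\<close> must be excluded, since powers of a
  relation are not cumulative.\<close>

lemma graph_dist_greater_iff:
  assumes "pair_graph G" and "u \<in> pverts G"
  shows "graph_dist G u v > ereal (real k) \<longleftrightarrow> (\<forall>n\<le>k. (u, v) \<notin> parcs G ^^ n)"
proof -
  interpret pair_graph G by fact
  have "graph_dist G u v > ereal (real k) \<longleftrightarrow> (\<forall>p. awalk u p v \<longrightarrow> length p > k)"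
  proof
    assume "graph_dist G u v > ereal (real k)"
    then show "\<forall>p. awalk u p v \<longrightarrow> length p > k"
      by (auto simp: graph_dist_eq[OF assms(1)] dest: less_INF_D)
  next
    assume "\<forall>p. awalk u p v \<longrightarrow> length p > k"
    \<comment> \<open>A strict bound need not survive an infimum; lengths being integers, it is
      sharpened to \<open>Suc k\<close> first. If there is no walk, the infimum is infinite.\<close>
    then have "ereal (real (Suc k)) \<le> graph_dist G u v"
      by (auto simp: graph_dist_eq[OF assms(1)] Suc_le_eq simp del: of_nat_Suc intro!: INF_greatest)
    then show "graph_dist G u v > ereal (real k)"
      by (rule less_le_trans[rotated]) simp
  qed
  also have "\<dots> \<longleftrightarrow> (\<forall>n\<le>k. (u, v) \<notin> parcs G ^^ n)"
    using awalk_relpow_iff[of u v] assms(2) by (metis not_le)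
  finally show ?thesis .
qed

lemma k_independent_iff_relpow:
  assumes "pair_graph G"
  shows "k_independent k G S \<longleftrightarrow>
    S \<subseteq> pverts G \<and> (\<forall>u\<in>S. \<forall>v\<in>S. u \<noteq> v \<longrightarrow> (\<forall>n\<le>k. (u, v) \<notin> parcs G ^^ n))"
  unfolding k_independent_def using graph_dist_greater_iff[OF assms] by (metis subsetD)

lemma finite_k_independent_cards:
  assumes "finite (pverts G)"
  shows "finite (card ` {S. k_independent k G S})"
  by (rule finite_imageI, rule finite_subset[of _ "Pow (pverts G)"])
    (auto simp: k_independent_def assms)

lemma card_le_k_independence_number:
  assumes "finite (pverts G)" and "k_independent k G S"
  shows "card S \<le> k_independence_number k G"
  unfolding k_independence_number_def
  using assms by (intro Max_ge finite_k_independent_cards) auto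

lemma maximum_k_independent_set:
  assumes "finite (pverts G)"
  obtains S where "k_independent k G S" and "card S = k_independence_number k G"
proof -
  have "k_independent k G {}"
    by (simp add: k_independent_def)
  then have "card ` {S. k_independent k G S} \<noteq> {}"
    by blast
  from Max_in[OF finite_k_independent_cards[OF assms] this] that show ?thesis
    unfolding k_independence_number_def by (metis (mono_tags, lifting) imageE mem_Collect_eq)
qed

text \<open>Makes the truncated subtraction of 1 from this number agree with integer
  subtraction.\<close>

lemma k_independence_number_pos:
  assumes "finite (pverts G)" and "pverts G \<noteq> {}"
  shows "k_independence_number k G \<ge> 1"
proof -
  obtain v where "v \<in> pverts G"
    using assms(2) by blast
  then have "k_independent k G {v}"
    by (simp add: k_independent_def)
  then show ?thesis
    using card_le_k_independence_number[OF assms(1)] by fastforce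
qed

section \<open>Isolated vertices\<close>

context pair_graph
begin

lemma isolated_vertices_iff: "v \<in> isolated_vertices G \<longleftrightarrow> v \<in> pverts G \<and> (\<forall>w. (v, w) \<notin> parcs G)"
  by (auto simp: isolated_vertices_def out_degree_def out_arcs_def card_eq_0_iff)

lemma finite_isolated_vertices: "finite (isolated_vertices G)"
  by (rule finite_subset[OF _ pair_finite_verts]) (auto simp: isolated_vertices_def)

text \<open>A nonempty walk has a first arc leaving \<open>u\<close> and a last arc entering
  \<open>v\<close>; by symmetry the latter also gives an arc leaving \<open>v\<close>.\<close>

lemma relpow_isolated:
  assumes "(u, v) \<in> parcs G ^^ n" and "u \<in> isolated_vertices G \<or> v \<in> isolated_vertices G"
  shows "u = v"
proof (cases n)
  case 0
  then show ?thesis using assms by simp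
next
  case (Suc m)
  then show ?thesis
    using assms arcs_symmetric
    by (metis isolated_vertices_iff relpow_Suc_D2 relpow_Suc_E)
qed

lemma k_independent_Un_isolated:
  assumes "k_independent k G S"
  shows "k_independent k G (S \<union> isolated_vertices G)"
  using assms relpow_isolated isolated_vertices_iff
  unfolding k_independent_iff_relpow[OF pair_graph_axioms] by blast

end

section \<open>Walks in the lexicographic product\<close>

locale lex_factors = G: pair_graph G + H: pair_graph H
  for G :: "'a pair_pre_digraph" and H :: "'b pair_pre_digraph"
begin

abbreviation GH :: "('a \<times> 'b) pair_pre_digraph" where
  "GH \<equiv> lex_product G H"

lemma pair_graph_GH: "pair_graph GH"
  by (rule pair_graph_lex_product) unfold_locales

lemma pverts_GH: "pverts GH = pverts G \<times> pverts H"
  by (simp add: lex_product_def)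

lemma finite_pverts_GH: "finite (pverts GH)"
  by (simp add: pverts_GH G.pair_finite_verts H.pair_finite_verts)

lemma parcs_GH_iff:
  "((u, x), (v, y)) \<in> parcs GH \<longleftrightarrow>
     x \<in> pverts H \<and> y \<in> pverts H \<and> u \<in> pverts G \<and> ((u, v) \<in> parcs G \<or> u = v \<and> (x, y) \<in> parcs H)"
  by (auto simp: lex_product_def dest: G.in_arcsD2)

text \<open>Each arc of the product projects to an arc of \<open>G\<close> or to a stationary step.
  Deleting the stationary steps may shorten the walk, hence \<open>m \<le> n\<close>.\<close>

lemma relpow_GH_fst:
  assumes "(a, b) \<in> parcs GH ^^ n"
  shows "\<exists>m\<le>n. (fst a, fst b) \<in> parcs G ^^ m"
  using assms
proof (induction n arbitrary: b)
  case 0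
  then show ?case by auto
next
  case (Suc n)
  then obtain c where c: "(a, c) \<in> parcs GH ^^ n" "(c, b) \<in> parcs GH"
    by auto
  then obtain m where m: "m \<le> n" "(fst a, fst c) \<in> parcs G ^^ m"
    using Suc.IH by blast
  consider "(fst c, fst b) \<in> parcs G" | "fst c = fst b"
    using c(2) by (metis parcs_GH_iff prod.collapse)
  then show ?case
  proof cases
    case 1
    then have "(fst a, fst b) \<in> parcs G ^^ Suc m"
      using m(2) by auto
    then show ?thesis using m(1) by (meson Suc_le_mono)
  next
    case 2
    then show ?thesis using m by (metis le_SucI)
  qed
qed

text \<open>Crossing an arc of \<open>G\<close> allows any change of the second coordinate. Positive
  length is essential: a walk of length 0 cannot change it.\<close>

lemma relpow_Suc_GH_I:
  assumes "(u, v) \<in> parcs G ^^ Suc n" and "x \<in> pverts H" and "y \<in> pverts H"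
  shows "((u, x), (v, y)) \<in> parcs GH ^^ Suc n"
  using assms
proof (induction n arbitrary: v y)
  case 0
  then show ?case by (auto simp: parcs_GH_iff dest: G.in_arcsD1)
next
  case (Suc n)
  then obtain w where "(u, w) \<in> parcs G ^^ Suc n" "(w, v) \<in> parcs G"
    by (meson relpow_Suc_E)
  \<comment> \<open>The second coordinate stays at \<open>x\<close> until the last arc, which moves
    it to \<open>y\<close>.\<close>
  then have "((u, x), (w, x)) \<in> parcs GH ^^ Suc n" "((w, x), (v, y)) \<in> parcs GH"
    using Suc by (auto simp: parcs_GH_iff dest: G.in_arcsD1)
  then show ?case by (meson relpow_Suc_I)
qed

text \<open>Step to a neighbour of \<open>u\<close> and back. This length 2 is the source of the
  hypothesis \<open>k \<ge> 2\<close>.\<close>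

lemma relpow_GH_non_isolated:
  assumes "u \<in> pverts G" and "u \<notin> isolated_vertices G" and "x \<in> pverts H" and "y \<in> pverts H"
  shows "((u, x), (u, y)) \<in> parcs GH ^^ 2"
proof -
  obtain w where "(u, w) \<in> parcs G"
    using assms G.isolated_vertices_iff by blast
  then have "(u, u) \<in> parcs G ^^ Suc 1"
    using G.arcs_symmetric by auto
  from relpow_Suc_GH_I[OF this assms(3,4)] show ?thesis
    by (simp add: numeral_2_eq_2)
qed

lemma relpow_GH_isolated_iff:
  assumes "u \<in> isolated_vertices G" and "x \<in> pverts H"
  shows "((u, x), (u, y)) \<in> parcs GH ^^ n \<longleftrightarrow> (x, y) \<in> parcs H ^^ n"
proof (induction n arbitrary: y)
  case 0
  then show ?case by auto
next
  case (Suc n)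
  have arc: "((u, z), (u, y)) \<in> parcs GH \<longleftrightarrow> (z, y) \<in> parcs H" for z
    using assms G.isolated_vertices_iff
    by (auto simp: parcs_GH_iff dest: H.in_arcsD1 H.in_arcsD2)
  \<comment> \<open>The walk projects to a walk in \<open>G\<close> from the isolated
    \<open>u\<close>, so it never leaves the copy of \<open>H\<close> over \<open>u\<close>.\<close>
  have fst_eq: "fst c = u" if "((u, x), c) \<in> parcs GH ^^ n" for c
    using relpow_GH_fst[OF that] G.relpow_isolated assms(1) by (metis fst_conv)
  have "((u, x), (u, y)) \<in> parcs GH ^^ Suc n \<longleftrightarrow>
      (\<exists>z. ((u, x), (u, z)) \<in> parcs GH ^^ n \<and> ((u, z), (u, y)) \<in> parcs GH)"
    using fst_eq by (fastforce simp: relcomp_unfold)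
  then show ?case
    by (auto simp: Suc.IH arc relcomp_unfold)
qed

section \<open>Upper bound: projection and fibres\<close>

lemma k_independent_fst_image:
  assumes "k_independent k GH S"
  shows "k_independent k G (fst ` S)"
  unfolding k_independent_iff_relpow[OF G.pair_graph_axioms]
proof (intro conjI ballI impI allI)
  show "fst ` S \<subseteq> pverts G"
    using assms by (auto simp: k_independent_def pverts_GH)
  fix u v n
  assume u: "u \<in> fst ` S" and v: "v \<in> fst ` S" and "u \<noteq> v" and "n \<le> k"
  show "(u, v) \<notin> parcs G ^^ n"
  proof
    assume uv: "(u, v) \<in> parcs G ^^ n"
    \<comment> \<open>Positive length lets the walk be lifted, with the same length, to any chosen
      preimages of \<open>u\<close> and \<open>v\<close>.\<close>
    with \<open>u \<noteq> v\<close> obtain m where m: "n = Suc m"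
      by (cases n) auto
    obtain x y where xy: "(u, x) \<in> S" "(v, y) \<in> S"
      using u v by auto
    then have "x \<in> pverts H" "y \<in> pverts H"
      using assms by (auto simp: k_independent_def pverts_GH)
    then have "((u, x), (v, y)) \<in> parcs GH ^^ n"
      using relpow_Suc_GH_I uv m by blast
    then show False
      using assms xy \<open>u \<noteq> v\<close> \<open>n \<le> k\<close>
      unfolding k_independent_iff_relpow[OF pair_graph_GH] by blast
  qed
qed

lemma card_fibre_non_isolated:
  assumes "k_independent k GH S" and "k \<ge> 2" and "u \<notin> isolated_vertices G"
  shows "card {x. (u, x) \<in> S} \<le> 1"
proof -
  have "x = y" if "(u, x) \<in> S" "(u, y) \<in> S" for x y
  proof (rule ccontr)
    assume "x \<noteq> y"
    have "u \<in> pverts G" "x \<in> pverts H" "y \<in> pverts H"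
      using assms(1) that by (auto simp: k_independent_def pverts_GH)
    from relpow_GH_non_isolated[OF this(1) assms(3) this(2,3)] show False
      using assms(1,2) that \<open>x \<noteq> y\<close>
      unfolding k_independent_iff_relpow[OF pair_graph_GH] by blast
  qed
  then have "\<exists>y. {x. (u, x) \<in> S} \<subseteq> {y}"
    by blast
  then show ?thesis
    using card_mono[of "{_}"] by fastforce
qed

lemma k_independent_fibre_isolated:
  assumes "k_independent k GH S" and "u \<in> isolated_vertices G"
  shows "k_independent k H {x. (u, x) \<in> S}"
proof -
  have sub: "x \<in> pverts H" if "(u, x) \<in> S" for x
    using assms(1) that by (auto simp: k_independent_def pverts_GH)
  have "(x, y) \<notin> parcs H ^^ n" if "(u, x) \<in> S" "(u, y) \<in> S" "x \<noteq> y" "n \<le> k" for x y n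
  proof -
    have "((u, x), (u, y)) \<notin> parcs GH ^^ n"
      using assms(1) that unfolding k_independent_iff_relpow[OF pair_graph_GH] by blast
    then show ?thesis
      using relpow_GH_isolated_iff[OF assms(2) sub[OF that(1)]] by blast
  qed
  then show ?thesis
    using sub by (auto simp: k_independent_iff_relpow[OF H.pair_graph_axioms])
qed

lemma card_k_independent_GH_le:
  assumes "k_independent k GH S" and "k \<ge> 2" and "pverts H \<noteq> {}"
  shows "card S \<le> k_independence_number k G
    + card (isolated_vertices G) * (k_independence_number k H - 1)"
proof -
  let ?I = "isolated_vertices G" and ?b = "k_independence_number k H"
  have b: "?b \<ge> 1"
    by (rule k_independence_number_pos[OF H.pair_finite_verts assms(3)])
  have finS: "finite S"
    using assms(1) finite_pverts_GH by (auto simp: k_independent_def intro: finite_subset)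
  have fin: "finite {x. (u, x) \<in> S}" for u
    by (rule finite_subset[of _ "snd ` S"]) (force simp: finS)+
  \<comment> \<open>Split so that the ones sum to the size of the projection, leaving an excess
    \<open>?b - 1\<close> only at its isolated vertices.\<close>
  have fibre: "card {x. (u, x) \<in> S} \<le> 1 + (if u \<in> ?I then ?b - 1 else 0)" for u
    using card_le_k_independence_number[OF H.pair_finite_verts k_independent_fibre_isolated[OF assms(1)]]
      card_fibre_non_isolated[OF assms(1,2)] b by auto
  have "S = (SIGMA u:fst ` S. {x. (u, x) \<in> S})"
    by force
  then have "card S = (\<Sum>u\<in>fst ` S. card {x. (u, x) \<in> S})"
    using card_SigmaI[of "fst ` S" "\<lambda>u. {x. (u, x) \<in> S}"] finS fin by simp
  also have "\<dots> \<le> (\<Sum>u\<in>fst ` S. 1 + (if u \<in> ?I then ?b - 1 else 0))"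
    by (rule sum_mono) (rule fibre)
  also have "\<dots> = card (fst ` S) + card (fst ` S \<inter> ?I) * (?b - 1)"
    unfolding sum.distrib by (simp add: finS sum.If_cases)
  also have "\<dots> \<le> k_independence_number k G + card ?I * (?b - 1)"
    by (intro add_mono mult_right_mono card_mono G.finite_isolated_vertices
        card_le_k_independence_number[OF G.pair_finite_verts] k_independent_fst_image[OF assms(1)]) auto
  finally show ?thesis .
qed

section \<open>Lower bound: an explicit independent set\<close>

lemma k_independent_GH_construct:
  assumes "k_independent k G S" and "k_independent k H T"
    and "w \<in> pverts H"
  shows "k_independent k GH
    ((S - isolated_vertices G) \<times> {w} \<union> isolated_vertices G \<times> T)" (is "k_independent k GH ?U")
  unfolding k_independent_iff_relpow[OF pair_graph_GH]
proof (intro conjI ballI impI allI)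
  let ?I = "isolated_vertices G"
  show "?U \<subseteq> pverts GH"
    using assms G.isolated_vertices_iff by (auto simp: k_independent_def pverts_GH)
  fix a b n
  assume a: "a \<in> ?U" and b: "b \<in> ?U" and "a \<noteq> b" and "n \<le> k"
  show "(a, b) \<notin> parcs GH ^^ n"
  proof
    assume ab: "(a, b) \<in> parcs GH ^^ n"
    show False
    proof (cases "fst a = fst b")
      \<comment> \<open>Over a non-isolated vertex \<open>?U\<close> has at most the point with
        second coordinate \<open>w\<close>, so two distinct points of one fibre lie over an isolated
        vertex.\<close>
      case True
      with a b \<open>a \<noteq> b\<close> obtain u x y where
        "a = (u, x)" "b = (u, y)" "u \<in> ?I" "x \<in> T" "y \<in> T" "x \<noteq> y"
        by (cases a; cases b) auto
      moreover have "x \<in> pverts H"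
        using \<open>x \<in> T\<close> assms(2) by (auto simp: k_independent_def)
      ultimately show False
        using ab \<open>n \<le> k\<close> relpow_GH_isolated_iff assms(2)
        unfolding k_independent_iff_relpow[OF H.pair_graph_axioms] by blast
    next
      case False
      \<comment> \<open>The projected walk has length at most \<open>k\<close> and joins distinct
        points of \<open>S \<union> ?I\<close>, which is still \<open>k\<close>-independent.\<close>
      obtain m where "m \<le> n" "(fst a, fst b) \<in> parcs G ^^ m"
        using relpow_GH_fst[OF ab] by blast
      moreover have "fst a \<in> S \<union> ?I" "fst b \<in> S \<union> ?I"
        using a b by auto
      ultimately show False
        using False \<open>n \<le> k\<close> G.k_independent_Un_isolated[OF assms(1)]
        unfolding k_independent_iff_relpow[OF G.pair_graph_axioms] by (meson le_trans)
    qed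
  qed
qed

lemma k_independence_number_GH_ge:
  assumes "pverts H \<noteq> {}"
  shows "k_independence_number k G + card (isolated_vertices G) * (k_independence_number k H - 1)
    \<le> k_independence_number k GH"
proof -
  let ?I = "isolated_vertices G"
  obtain w where w: "w \<in> pverts H"
    using assms by blast
  obtain S where S: "k_independent k G S" "card S = k_independence_number k G"
    using maximum_k_independent_set[OF G.pair_finite_verts] .
  obtain T where T: "k_independent k H T" "card T = k_independence_number k H"
    using maximum_k_independent_set[OF H.pair_finite_verts] .
  have fin: "finite S" "finite T"
    using S(1) T(1) G.pair_finite_verts H.pair_finite_verts
    by (auto simp: k_independent_def intro: finite_subset)
  let ?U = "(S - ?I) \<times> {w} \<union> ?I \<times> T"
  \<comment> \<open>\<open>S\<close> need not contain \<open>?I\<close>; replacing it by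
    \<open>(S - ?I) \<union> ?I\<close> does not decrease its size.\<close>
  have "card S + card ?I * (card T - 1) \<le> card (S - ?I) + card ?I + card ?I * (card T - 1)"
    using diff_card_le_card_Diff[OF G.finite_isolated_vertices, of S] by simp
  also have "\<dots> = card (S - ?I) + card ?I * card T"
  proof -
    have "card T \<ge> 1"
      using k_independence_number_pos[OF H.pair_finite_verts assms] T(2) by simp
    then show ?thesis
      by (cases "card T") simp_all
  qed
  also have "\<dots> = card ?U"
    using fin G.finite_isolated_vertices
    by (subst card_Un_disjoint) (auto simp: card_cartesian_product)
  also have "\<dots> \<le> k_independence_number k GH"
    by (rule card_le_k_independence_number[OF finite_pverts_GH
          k_independent_GH_construct[OF S(1) T(1) w]])
  finally show ?thesis
    using S(2) T(2) by simp
qed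

end

theorem theorem5p4:
  fixes G1 :: "'a pair_pre_digraph" and G2 :: "'b pair_pre_digraph" and k :: nat
  assumes "pair_graph G1" and "pverts G1 \<noteq> {}"
    and "pair_graph G2" and "pverts G2 \<noteq> {}"
    and "k \<ge> 2"
  shows "int (k_independence_number k (lex_product G1 G2)) =
    int (k_independence_number k G1)
      + int (card (isolated_vertices G1)) * (int (k_independence_number k G2) - 1)"
proof -
  interpret lex_factors G1 G2
    by (intro lex_factors.intro assms)
  obtain S where "k_independent k GH S" "card S = k_independence_number k GH"
    using maximum_k_independent_set[OF finite_pverts_GH] .
  then have "k_independence_number k GH \<le> k_independence_number k G1
      + card (isolated_vertices G1) * (k_independence_number k G2 - 1)"
    using card_k_independent_GH_le assms(4,5) by metis
  then have "k_independence_number k GH = k_independence_number k G1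
      + card (isolated_vertices G1) * (k_independence_number k G2 - 1)"
    using k_independence_number_GH_ge[OF assms(4)] by (rule antisym)
  then show ?thesis
    using k_independence_number_pos[OF H.pair_finite_verts assms(4), of k]
    by (simp add: of_nat_diff)
qed

end
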